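(* Let $K$ be a field of characteristic zero and let $\mathfrak{G}$ be a weakly Noetherian Lie algebra over $K$. Then any maximal ideal of $\mathfrak{G}$ of codimension $>1$ (finite or infinite) is characteristic.
   Context: A Lie algebra $\mathfrak{G}$ over $K$ is weakly Noetherian if $\dim\mathfrak{m}/[\mathfrak{m},\mathfrak{m}]<\infty$ for every Lie subalgebra $\mathfrak{m}\subset\mathfrak{G}$. An ideal $\mathfrak{m}$ of $\mathfrak{G}$ is characteristic if $\partial\mathfrak{m}\subset\mathfrak{m}$ for every derivation $\partial$ of $\mathfrak{G}$. *)

theory Defs
  imports Complex_Main "HOL-Library.Extended_Nat"
begin

locale lie_algebra = vector_space scale
  for scale :: "'a::field \<Rightarrow> 'b::ab_group_add \<Rightarrow> 'b" +
  fixes bracket :: "'b \<Rightarrow> 'b \<Rightarrow> 'b"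
  assumes linear_bracket_left: "Vector_Spaces.linear scale scale (\<lambda>x. bracket x y)"
    and linear_bracket_right: "Vector_Spaces.linear scale scale (\<lambda>y. bracket x y)"
    and bracket_self: "bracket x x = 0"
    and jacobi: "bracket x (bracket y z) + bracket y (bracket z x) + bracket z (bracket x y) = 0"
begin

(* For subspaces W <= V, the set B of representatives is such that the cosets b + W, for b in B,
   are pairwise distinct and form a basis of the quotient space V / W.
   A linear combination of these cosets is zero in V / W iff the same linear combination
   of the representatives lies in W. *)
definition basis_of_quotient :: "'b set \<Rightarrow> 'b set \<Rightarrow> 'b set \<Rightarrow> bool" where
  "basis_of_quotient V W B \<longleftrightarrow>
     B \<subseteq> V \<and>
     (\<forall>t u. finite t \<and> t \<subseteq> B \<and> (\<Sum>b\<in>t. scale (u b) b) \<in> W \<longrightarrow> (\<forall>b\<in>t. u b = 0)) \<and>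
     (\<forall>v\<in>V. \<exists>x\<in>span B. v - x \<in> W)"

(* The library constant dim returns 0 for infinite-dimensional spaces, hence the type enat.
   The choice of the basis does not matter, see basis_of_quotient_imp_quotient_dim. *)
definition quotient_dim :: "'b set \<Rightarrow> 'b set \<Rightarrow> enat" where
  "quotient_dim V W =
     (if \<exists>B. finite B \<and> basis_of_quotient V W B
      then enat (card (SOME B. finite B \<and> basis_of_quotient V W B)) else \<infinity>)"

lemma basis_of_quotient_card_le:
  assumes W: "subspace W" and B: "basis_of_quotient V W B" "finite B"
    and C: "basis_of_quotient V W C"
  shows "finite C \<and> card C \<le> card B"
proof -
  obtain D where D: "D \<subseteq> W" "independent D" "W \<subseteq> span D"
    using maximal_independent_subset by blast
  have spD: "span D = W"
    using D W by (meson span_subspace)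
  interpret vp: vector_space_pair scale scale ..
  define E where "E = extend_basis D"
  have E: "D \<subseteq> E" "independent E" "span E = UNIV"
    unfolding E_def using D(2) extend_basis_superset independent_extend_basis span_extend_basis
    by auto
  define p where "p = vp.construct E (\<lambda>b. if b \<in> D then 0 else b)"
  have lp: "Vector_Spaces.linear scale scale p"
    unfolding p_def by (rule vp.linear_construct[OF E(2)])
  interpret p: Vector_Spaces.linear scale scale p by (rule lp)
  have pE: "p b = (if b \<in> D then 0 else b)" if "b \<in> E" for b
    unfolding p_def using vp.construct_basis[OF E(2) that] by simp
  have ker1: "p w = 0" if "w \<in> W" for w
  proof -
    have "w \<in> span D" using that spD by simp
    moreover have "p b = 0" if "b \<in> D" for b using that pE[of b] E(1) by auto
    ultimately show ?thesis by (rule p.eq_0_on_span[rotated])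
  qed
  have diff: "x - p x \<in> W" for x
  proof -
    have "x \<in> span E" using E(3) by simp
    then show ?thesis
    proof (induction rule: span_induct_alt)
      case base
      then show ?case using W by (simp add: p.zero subspace_0)
    next
      case (step c x y)
      have "x - p x \<in> W" using step D(1) W by (auto simp: pE subspace_0)
      then have "scale c (x - p x) + (y - p y) \<in> W"
        using step W by (simp add: subspace_add subspace_scale)
      also have "scale c (x - p x) + (y - p y) = (scale c x + y) - p (scale c x + y)"
        by (simp add: p.add p.scale algebra_simps)
      finally show ?case .
    qed
  qed
  have ker: "p x = 0 \<longleftrightarrow> x \<in> W" for x
    using ker1 diff[of x] by auto
  have indep: "inj_on p C \<and> independent (p ` C)"
  proof -
    have *: "\<forall>b\<in>t. u b = 0" if "finite t" "t \<subseteq> C" "(\<Sum>b\<in>t. scale (u b) (p b)) = 0" for t u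
    proof -
      have "p (\<Sum>b\<in>t. scale (u b) b) = 0" using that(3) by (simp add: p.sum p.scale)
      then show ?thesis using C that(1,2) unfolding ker basis_of_quotient_def by blast
    qed
    have inj: "inj_on p C"
    proof (rule inj_onI, rule ccontr)
      fix a b assume ab: "a \<in> C" "b \<in> C" "p a = p b" "a \<noteq> b"
      have "(\<Sum>x\<in>{a,b}. scale (if x = a then 1 else - 1) (p x)) = 0" using ab by simp
      from *[OF _ _ this] ab show False by (auto split: if_splits)
    qed
    have "independent (p ` C)"
      unfolding independent_explicit_module
    proof (intro allI impI)
      fix t u v assume t: "finite t" "t \<subseteq> p ` C" "(\<Sum>v\<in>t. scale (u v) v) = 0" "v \<in> t"
      obtain s where s: "s \<subseteq> C" "t = p ` s" using t(2) by (meson subset_imageE)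
      have inj_s: "inj_on p s" using inj s inj_on_subset by blast
      have "finite s" using t(1) s inj_s finite_imageD by blast
      moreover have "(\<Sum>b\<in>s. scale (u (p b)) (p b)) = 0"
        using t(3) s inj_s by (simp add: sum.reindex)
      ultimately show "u v = 0" using *[of s "\<lambda>b. u (p b)"] s t(4) by auto
    qed
    with inj show ?thesis by simp
  qed
  have "p ` C \<subseteq> span (p ` B)"
  proof
    fix y assume "y \<in> p ` C"
    then obtain c where c: "c \<in> C" "y = p c" by auto
    then have "c \<in> V" using C by (auto simp: basis_of_quotient_def)
    then obtain x where x: "x \<in> span B" "c - x \<in> W"
      using B(1) by (auto simp: basis_of_quotient_def)
    have "p c = p x" using ker1[OF x(2)] by (simp add: p.diff)
    also have "\<dots> \<in> span (p ` B)" using x(1) p.span_image by auto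
    finally show "y \<in> span (p ` B)" using c by simp
  qed
  then have "finite (p ` C) \<and> card (p ` C) \<le> card (p ` B)"
    using independent_span_bound[of "p ` B" "p ` C"] indep B(2) by auto
  then show ?thesis
    using indep card_image[of p C] card_image_le[OF B(2), of p] finite_imageD[of p C] by auto
qed

lemma basis_of_quotient_imp_quotient_dim:
  assumes W: "subspace W" and B: "basis_of_quotient V W B"
  shows "quotient_dim V W = (if finite B then enat (card B) else \<infinity>)"
proof (cases "\<exists>C. finite C \<and> basis_of_quotient V W C")
  case True
  define C where "C = (SOME C. finite C \<and> basis_of_quotient V W C)"
  have C: "finite C" "basis_of_quotient V W C"
    using someI_ex[OF True] unfolding C_def by auto
  have q: "quotient_dim V W = enat (card C)"
    using True unfolding quotient_dim_def C_def by simp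
  have "finite B" "card B \<le> card C"
    using basis_of_quotient_card_le[OF W C(2,1) B] by auto
  moreover have "card C \<le> card B"
    using basis_of_quotient_card_le[OF W B \<open>finite B\<close> C(2)] by auto
  ultimately show ?thesis using q by simp
next
  case False
  then show ?thesis using B by (auto simp: quotient_dim_def)
qed

definition lie_subalgebra :: "'b set \<Rightarrow> bool" where
  "lie_subalgebra M \<longleftrightarrow> subspace M \<and> (\<forall>x\<in>M. \<forall>y\<in>M. bracket x y \<in> M)"

definition derived_subalgebra :: "'b set \<Rightarrow> 'b set" where
  "derived_subalgebra M = span {bracket x y | x y. x \<in> M \<and> y \<in> M}"

definition weakly_noetherian :: bool where
  "weakly_noetherian \<longleftrightarrow>
     (\<forall>M. lie_subalgebra M \<longrightarrow> quotient_dim M (derived_subalgebra M) < \<infinity>)"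

definition lie_ideal :: "'b set \<Rightarrow> bool" where
  "lie_ideal I \<longleftrightarrow> subspace I \<and> (\<forall>x. \<forall>y\<in>I. bracket x y \<in> I)"

definition maximal_lie_ideal :: "'b set \<Rightarrow> bool" where
  "maximal_lie_ideal M \<longleftrightarrow>
     lie_ideal M \<and> M \<noteq> UNIV \<and> (\<forall>J. lie_ideal J \<and> M \<subseteq> J \<longrightarrow> J = M \<or> J = UNIV)"

definition lie_derivation :: "('b \<Rightarrow> 'b) \<Rightarrow> bool" where
  "lie_derivation D \<longleftrightarrow>
     Vector_Spaces.linear scale scale D \<and>
     (\<forall>x y. D (bracket x y) = bracket (D x) y + bracket x (D y))"

definition characteristic_ideal :: "'b set \<Rightarrow> bool" where
  "characteristic_ideal M \<longleftrightarrow> lie_ideal M \<and> (\<forall>D. lie_derivation D \<longrightarrow> D ` M \<subseteq> M)"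

end

end

theory Submission
  imports Defs
begin

text \<open>
  Suppose that a derivation \<open>D\<close> does not preserve \<open>M\<close>. Then \<open>M + D M\<close> is an ideal, hence everything.
  Let \<open>W d\<close> be the set of all \<open>x\<close> with \<open>D\<^sup>i x \<in> M\<close> for \<open>i < d\<close>. Then \<open>[W i, W j] \<subseteq> W (i + j)\<close>, and since
  \<open>G / M\<close> is simple and not abelian, \<open>D\<^sup>d\<close> maps \<open>W d\<close> onto \<open>G / M\<close> for all \<open>d\<close>. As \<open>[M, M] \<subseteq> W 2\<close>,
  the algebra \<open>G / M\<close> is a quotient of \<open>M / [M, M]\<close> and has finite dimension.

  Consider the Lie polynomials \<open>f\<^bsub>0\<^esub>(x) = x\<close> and
  \<open>f\<^bsub>k+1\<^esub>(x; y, ys) = [f\<^bsub>k\<^esub>(x; ys), f\<^bsub>k\<^esub>(y; ys)]\<close>. They are linear in \<open>x\<close>, and in each step the kernel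
  on \<open>G / M\<close> grows, because \<open>y\<close> is added to it. Hence there is a last \<open>k\<close> for which \<open>f\<^bsub>k\<^esub>\<close> does not
  vanish on \<open>G / M\<close>, say \<open>f\<^bsub>k\<^esub>(x; ys) \<notin> M\<close>. The identity \<open>f\<^bsub>k+1\<^esub> = 0\<close> of \<open>G / M\<close> is inherited by
  \<open>G / I\<close>, where \<open>I\<close> is the intersection of all \<open>W d\<close>. Choose \<open>g\<^bsub>d\<^esub> \<in> W d\<close> with
  \<open>D\<^sup>d g\<^bsub>d\<^esub> \<in> x + M\<close>. The elements \<open>f\<^bsub>k\<^esub>(g\<^bsub>d\<^esub>; ys)\<close> lie in \<open>W d\<close> but not in \<open>W (d + 1)\<close> and commute modulo
  \<open>I\<close>. So together with \<open>I\<close> they span a subalgebra whose abelianization has infinite dimension.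
\<close>

section \<open>Linear algebra: exchange, descending chains, coefficients of polynomials\<close>

context vector_space
begin

text \<open>Steinitz exchange relative to \<open>K\<close>: some \<open>b\<close> in
  \<open>C\<close> occurs essentially in \<open>y\<close>, so it can be solved for.\<close>

lemma span_exchange_finite:
  assumes "finite C" "y \<in> span (K \<union> C)" "y \<notin> span K"
  shows "\<exists>b\<in>C. b \<in> span (insert y (K \<union> (C - {b})))"
  using assms
proof (induction C rule: finite_induct)
  case empty
  then show ?case by simp
next
  case (insert b C)
  show ?case
  proof (cases "y \<in> span (K \<union> C)")
    case True
    then obtain b' where b': "b' \<in> C" "b' \<in> span (insert y (K \<union> (C - {b'})))"
      using insert by blast
    then have "b' \<in> span (insert y (K \<union> (insert b C - {b'})))"
      using span_mono[of "insert y (K \<union> (C - {b'}))" "insert y (K \<union> (insert b C - {b'}))"] by blast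
    then show ?thesis using b'(1) by blast
  next
    case False
    have "y \<in> span (insert b (K \<union> C))" using insert.prems by simp
    from in_span_insert[OF this False] show ?thesis using insert.hyps by simp
  qed
qed

end

text \<open>Each \<open>u d\<close> lies outside \<open>W (Suc d)\<close>, which contains the span
  of all later ones, so arbitrarily long blocks are independent.\<close>

lemma (in vector_space) descending_not_finite_span:
  assumes W: "\<And>d. subspace (W d)" and dec: "\<And>d. W (Suc d) \<subseteq> W d"
    and u: "\<And>d. u d \<in> W d" "\<And>d. u d \<notin> W (Suc d)" "\<And>d. u d \<in> span B"
  shows "infinite B"
proof
  assume B: "finite B"
  have W_mono: "W e \<subseteq> W d" if "d \<le> e" for d e :: nat
    using that dec by (rule lift_Suc_antimono_le[rotated])
  \<comment> \<open>The start \<open>d\<close> varies because the induction adds the vector of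
    lowest index.\<close>
  have *: "independent (u ` {d..<d + k}) \<and> card (u ` {d..<d + k}) = k" for d k
  proof (induction k arbitrary: d)
    case 0
    then show ?case by (simp add: independent_empty)
  next
    case (Suc k)
    have eq: "u ` {d..<d + Suc k} = insert (u d) (u ` {Suc d..<Suc d + k})"
    proof -
      have "{d..<d + Suc k} = insert d {Suc d..<Suc d + k}" by auto
      then show ?thesis by (simp only: image_insert)
    qed
    have "u ` {Suc d..<Suc d + k} \<subseteq> W (Suc d)"
    proof
      fix z assume "z \<in> u ` {Suc d..<Suc d + k}"
      then obtain e where "z = u e" "Suc d \<le> e" by auto
      then show "z \<in> W (Suc d)" using W_mono u(1) by blast
    qed
    then have "span (u ` {Suc d..<Suc d + k}) \<subseteq> W (Suc d)" using W by (rule span_minimal)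
    then have n: "u d \<notin> span (u ` {Suc d..<Suc d + k})" using u(2) by blast
    then have "u d \<notin> u ` {Suc d..<Suc d + k}" using span_base by blast
    then show ?case using Suc[of "Suc d"] n unfolding eq by (simp add: independent_insert)
  qed
  have "u ` {0..<0 + Suc (card B)} \<subseteq> span B" using u(3) by blast
  then have "card (u ` {0..<0 + Suc (card B)}) \<le> card B"
    using independent_span_bound[OF B] * by blast
  then show False using *[of 0 "Suc (card B)"] by simp
qed

text \<open>Replaces a Vandermonde argument: the top coefficient is eliminated, and in
  characteristic zero the factors \<open>2 ^ j - 2 ^ N\<close> on the others are invertible.\<close>

lemma polynomial_coeffs_in_subspace:
  fixes scale :: "'k::field_char_0 \<Rightarrow> 'g::ab_group_add \<Rightarrow> 'g" and c :: "nat \<Rightarrow> 'g"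
  assumes "vector_space scale" and W: "module.subspace scale W"
    and "\<And>s. (\<Sum>j<N. scale (s ^ j) (c j)) \<in> W" and "j < N"
  shows "c j \<in> W"
proof -
  interpret vector_space scale by fact
  show ?thesis using assms(3,4)
  proof (induction N arbitrary: c j)
    case 0
    then show ?case by simp
  next
    case (Suc N)
    let ?p = "\<lambda>s. \<Sum>j<Suc N. scale (s ^ j) (c j)"
    \<comment> \<open>\<open>p (2 s) - 2\<^sup>N p s\<close> has a smaller degree.\<close>
    have "(\<Sum>j<N. scale (s ^ j) (scale (2 ^ j - 2 ^ N) (c j))) = ?p (2 * s) - scale (2 ^ N) (?p s)" for s
      by (simp add: scale_sum_right scale_right_distrib power_mult_distrib
          sum_subtractf[symmetric] algebra_simps)
    moreover have "?p (2 * s) - scale (2 ^ N) (?p s) \<in> W" for s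
      using W Suc.prems(1) by (intro subspace_diff subspace_scale)
    ultimately have "scale (2 ^ i - 2 ^ N) (c i) \<in> W" if "i < N" for i
      using Suc.IH[of "\<lambda>j. scale (2 ^ j - 2 ^ N) (c j)" i] that by simp
    then have *: "c i \<in> W" if "i < N" for i
    proof -
      have "(2::'k) ^ i \<noteq> 2 ^ N"
        using that by (metis nat_neq_iff of_nat_eq_iff of_nat_numeral of_nat_power one_less_numeral_iff
            power_inject_exp semiring_norm(76))
      then have "c i = scale (inverse (2 ^ i - 2 ^ N)) (scale (2 ^ i - 2 ^ N) (c i))" by simp
      then show ?thesis using subspace_scale[OF W] \<open>\<And>i. i < N \<Longrightarrow> scale (2 ^ i - 2 ^ N) (c i) \<in> W\<close> that
        by metis
    qed
    have "(\<Sum>j<N. c j) \<in> W" using * W by (intro subspace_sum) auto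
    \<comment> \<open>The value at \<open>s = 1\<close> is the sum of all coefficients, which
      isolates the top one.\<close>
    moreover have "(\<Sum>j<N. c j) + c N \<in> W" using Suc.prems(1)[of 1] by simp
    ultimately have "c N \<in> W" using subspace_diff[OF W] by fastforce
    then show ?case using * Suc.prems(2) by (auto simp: less_Suc_eq)
  qed
qed

section \<open>Bracket calculus and maximal ideals\<close>

context lie_algebra
begin

lemma bracket_add_left: "bracket (x + y) z = bracket x z + bracket y z"
proof -
  interpret l: Vector_Spaces.linear scale scale "\<lambda>x. bracket x z" by (rule linear_bracket_left)
  show ?thesis by (rule l.add)
qed

lemma bracket_add_right: "bracket z (x + y) = bracket z x + bracket z y"
proof -
  interpret l: Vector_Spaces.linear scale scale "\<lambda>x. bracket z x" by (rule linear_bracket_right)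
  show ?thesis by (rule l.add)
qed

lemma bracket_scale_left: "bracket (scale c x) z = scale c (bracket x z)"
proof -
  interpret l: Vector_Spaces.linear scale scale "\<lambda>x. bracket x z" by (rule linear_bracket_left)
  show ?thesis by (rule l.scale)
qed

lemma bracket_scale_right: "bracket z (scale c x) = scale c (bracket z x)"
proof -
  interpret l: Vector_Spaces.linear scale scale "\<lambda>x. bracket z x" by (rule linear_bracket_right)
  show ?thesis by (rule l.scale)
qed

lemma bracket_diff_left: "bracket (x - y) z = bracket x z - bracket y z"
proof -
  interpret l: Vector_Spaces.linear scale scale "\<lambda>x. bracket x z" by (rule linear_bracket_left)
  show ?thesis by (rule l.diff)
qed

lemma bracket_diff_right: "bracket z (x - y) = bracket z x - bracket z y"
proof -
  interpret l: Vector_Spaces.linear scale scale "\<lambda>x. bracket z x" by (rule linear_bracket_right)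
  show ?thesis by (rule l.diff)
qed

lemma bracket_zero_left: "bracket 0 z = 0"
  using bracket_diff_left[of 0 0] by simp

lemma bracket_zero_right: "bracket z 0 = 0"
  using bracket_diff_right[of z 0 0] by simp

lemma bracket_sum_left: "bracket (sum h A) z = (\<Sum>a\<in>A. bracket (h a) z)"
proof -
  interpret l: Vector_Spaces.linear scale scale "\<lambda>x. bracket x z" by (rule linear_bracket_left)
  show ?thesis by (rule l.sum)
qed

lemma bracket_sum_right: "bracket z (sum h A) = (\<Sum>a\<in>A. bracket z (h a))"
proof -
  interpret l: Vector_Spaces.linear scale scale "\<lambda>x. bracket z x" by (rule linear_bracket_right)
  show ?thesis by (rule l.sum)
qed

lemma bracket_swap: "bracket x y = - bracket y x"
proof -
  have "bracket (x + y) (x + y) = bracket x y + bracket y x"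
    by (simp only: bracket_add_left bracket_add_right) (simp add: bracket_self)
  then show ?thesis using bracket_self[of "x + y"] by (simp add: eq_neg_iff_add_eq_0)
qed

lemma lie_ideal_bracket_left: "lie_ideal I \<Longrightarrow> x \<in> I \<Longrightarrow> bracket x y \<in> I"
  using bracket_swap[of x y] subspace_neg[of I] by (auto simp: lie_ideal_def)

lemma bracket_span_mem:
  assumes W: "subspace W" and X: "\<And>x y. x \<in> X \<Longrightarrow> y \<in> X \<Longrightarrow> bracket x y \<in> W"
    and x: "x \<in> span X" and y: "y \<in> span X"
  shows "bracket x y \<in> W"
proof -
  have 1: "bracket a y \<in> W" if "a \<in> X" for a
    using y
  proof (induction rule: span_induct_alt)
    case base
    then show ?case using W by (simp add: bracket_zero_right subspace_0)
  next
    case (step c u v)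
    then show ?case using W X that
      by (simp add: bracket_add_right bracket_scale_right subspace_add subspace_scale)
  qed
  show ?thesis using x
  proof (induction rule: span_induct_alt)
    case base
    then show ?case using W by (simp add: bracket_zero_left subspace_0)
  next
    case (step c u v)
    then show ?case using W 1
      by (simp add: bracket_add_left bracket_scale_left subspace_add subspace_scale)
  qed
qed

text \<open>Cauchy product in \<open>s\<close>. The bound \<open>N + N'\<close> exceeds every
  exponent \<open>i + j\<close>; surplus coefficients are empty sums.\<close>

lemma bracket_polynomials:
  "bracket (\<Sum>i<N. scale (s ^ i) (c i)) (\<Sum>j<N'. scale (s ^ j) (d j)) =
    (\<Sum>k<N + N'. scale (s ^ k)
      (\<Sum>(i, j) | (i, j) \<in> {..<N} \<times> {..<N'} \<and> i + j = k. bracket (c i) (d j)))"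
proof -
  let ?S = "{..<N} \<times> {..<N'}"
  have "bracket (\<Sum>i<N. scale (s ^ i) (c i)) (\<Sum>j<N'. scale (s ^ j) (d j)) =
    (\<Sum>i<N. bracket (scale (s ^ i) (c i)) (\<Sum>j<N'. scale (s ^ j) (d j)))"
    by (rule bracket_sum_left)
  also have "\<dots> = (\<Sum>i<N. \<Sum>j<N'. scale (s ^ (i + j)) (bracket (c i) (d j)))"
    by (simp add: bracket_sum_right bracket_scale_left bracket_scale_right power_add mult.commute
        scale_sum_right)
  also have "\<dots> = (\<Sum>p\<in>?S. scale (s ^ (fst p + snd p)) (bracket (c (fst p)) (d (snd p))))"
    by (simp add: sum.cartesian_product case_prod_unfold)
  also have "\<dots> = (\<Sum>k<N + N'. \<Sum>p | p \<in> ?S \<and> fst p + snd p = k.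
      scale (s ^ (fst p + snd p)) (bracket (c (fst p)) (d (snd p))))"
    by (rule sum.group[symmetric]) auto
  also have "\<dots> = (\<Sum>k<N + N'. scale (s ^ k)
      (\<Sum>(i, j) | (i, j) \<in> ?S \<and> i + j = k. bracket (c i) (d j)))"
    by (intro sum.cong refl) (auto simp: scale_sum_right case_prod_unfold intro!: sum.cong)
  finally show ?thesis .
qed

lemma quotient_dim_finiteE:
  assumes "quotient_dim V W < \<infinity>"
  obtains B where "finite B" "B \<subseteq> V" "\<And>v. v \<in> V \<Longrightarrow> \<exists>x\<in>span B. v - x \<in> W"
proof -
  have "\<exists>B. finite B \<and> basis_of_quotient V W B"
    using assms by (auto simp: quotient_dim_def split: if_splits)
  then show ?thesis using that by (auto simp: basis_of_quotient_def)
qed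

text \<open>If all brackets fell into \<open>M\<close>, every subspace above \<open>M\<close> would
  be an ideal; by maximality \<open>M\<close> and one further vector would span everything, giving
  codimension 1.\<close>

lemma maximal_ideal_not_abelian:
  assumes M: "maximal_lie_ideal M" and dim: "quotient_dim UNIV M > 1"
  shows "\<exists>x y. bracket x y \<notin> M"
proof (rule ccontr)
  assume "\<not> ?thesis"
  then have ab: "bracket x y \<in> M" for x y by blast
  have sM: "subspace M" and "M \<noteq> UNIV" using M by (auto simp: maximal_lie_ideal_def lie_ideal_def)
  then obtain v where v: "v \<notin> M" by auto
  have MJ: "M \<subseteq> span (insert v M)" using span_superset by blast
  then have "lie_ideal (span (insert v M))" using ab by (auto simp: lie_ideal_def)
  moreover have "span (insert v M) \<noteq> M" using v span_base[of v "insert v M"] by auto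
  ultimately have U: "span (insert v M) = UNIV" using M MJ unfolding maximal_lie_ideal_def by blast
  have "basis_of_quotient UNIV M {v}"
    unfolding basis_of_quotient_def
  proof (intro conjI allI impI ballI)
    fix t u b
    assume t: "finite t \<and> t \<subseteq> {v} \<and> (\<Sum>b\<in>t. scale (u b) b) \<in> M" and b: "b \<in> t"
    then have "t = {v}" "b = v" by auto
    then have uv: "scale (u v) v \<in> M" using t by simp
    show "u b = 0"
    proof (rule ccontr)
      assume "u b \<noteq> 0"
      then have "v = scale (inverse (u v)) (scale (u v) v)" using \<open>b = v\<close> by simp
      then show False using subspace_scale[OF sM uv] v by metis
    qed
  next
    fix g
    have "g \<in> span (insert v M)" using U by simp
    then obtain k where "g - scale k v \<in> span M" using span_breakdown_eq by blast
    moreover have "span M = M" using sM by (simp add: span_eq_iff)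
    moreover have "scale k v \<in> span {v}" by (simp add: span_base span_scale)
    ultimately show "\<exists>x\<in>span {v}. g - x \<in> M" by blast
  qed auto
  from basis_of_quotient_imp_quotient_dim[OF sM this] dim show False
    by (simp add: one_enat_def)
qed

section \<open>Nested brackets and their kernels modulo an ideal\<close>

fun nested_bracket :: "'b list \<Rightarrow> 'b \<Rightarrow> 'b" where
  "nested_bracket [] x = x"
| "nested_bracket (y # ys) x = bracket (nested_bracket ys x) (nested_bracket ys y)"

lemma nested_bracket_add: "nested_bracket ys (x + x') = nested_bracket ys x + nested_bracket ys x'"
  by (induction ys) (simp_all add: bracket_add_left)

lemma nested_bracket_scale: "nested_bracket ys (scale c x) = scale c (nested_bracket ys x)"
  by (induction ys) (simp_all add: bracket_scale_left)

lemma nested_bracket_diff: "nested_bracket ys (x - x') = nested_bracket ys x - nested_bracket ys x'"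
  by (induction ys) (simp_all add: bracket_diff_left)

lemma nested_bracket_ideal: "lie_ideal I \<Longrightarrow> x \<in> I \<Longrightarrow> nested_bracket ys x \<in> I"
  by (induction ys) (simp_all add: lie_ideal_bracket_left)

lemma subspace_nested_bracket_kernel:
  assumes "subspace I"
  shows "subspace {x. nested_bracket ys x \<in> I}"
proof -
  have "nested_bracket ys 0 = 0" using nested_bracket_diff[of ys 0 0] by simp
  then show ?thesis
    using assms by (simp add: subspace_def nested_bracket_add nested_bracket_scale)
qed

text \<open>Each entry of \<open>ys\<close> saves one vector of a set spanning everything modulo the
  kernel, so a nested bracket that is nonzero modulo \<open>I\<close> has at most
  \<open>card B\<close> entries.\<close>

lemma nested_bracket_kernel_codim:
  assumes I: "lie_ideal I" and B: "finite B" "span (I \<union> B) = UNIV"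
    and "nested_bracket ys z \<notin> I"
  shows "\<exists>C. finite C \<and> card C + length ys \<le> card B \<and>
    span ({x. nested_bracket ys x \<in> I} \<union> C) = UNIV"
  using assms(4)
proof (induction ys arbitrary: z)
  case Nil
  then show ?case using B by auto
next
  case (Cons y ys)
  let ?K = "{x. nested_bracket ys x \<in> I}" and ?K' = "{x. nested_bracket (y # ys) x \<in> I}"
  have sI: "subspace I" using I by (simp add: lie_ideal_def)
  have zI: "bracket (nested_bracket ys z) (nested_bracket ys y) \<notin> I" using Cons.prems by simp
  then have "nested_bracket ys z \<notin> I" and y: "y \<notin> ?K"
    using I lie_ideal_bracket_left by (auto simp: lie_ideal_def)
  from Cons.IH[OF this(1)] obtain C where C: "finite C" "card C + length ys \<le> card B"
    "span (?K \<union> C) = UNIV" by blast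
  have "span ?K = ?K" using subspace_nested_bracket_kernel[OF sI] by (simp only: span_eq_iff)
  then have "y \<notin> span ?K" using y by (simp only:) simp
  moreover have "y \<in> span (?K \<union> C)" using C(3) by (simp only: UNIV_I)
  ultimately obtain b where b: "b \<in> C" "b \<in> span (insert y (?K \<union> (C - {b})))"
    using span_exchange_finite[OF C(1)] by blast
  \<comment> \<open>The old kernel survives because \<open>I\<close> is an ideal, and
    \<open>y\<close> joins it because the outer bracket then has equal arguments.\<close>
  have "insert y ?K \<subseteq> ?K'"
    using I sI by (auto simp: bracket_self subspace_0 lie_ideal_bracket_left)
  then have sub: "insert y (?K \<union> (C - {b})) \<subseteq> ?K' \<union> (C - {b})" by blast
  then have "b \<in> span (?K' \<union> (C - {b}))" using b(2) span_mono by blast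
  then have "?K \<union> C \<subseteq> span (?K' \<union> (C - {b}))"
    using sub span_superset[of "?K' \<union> (C - {b})"] by blast
  then have "span (?K' \<union> (C - {b})) = UNIV"
    using C(3) span_minimal[OF _ subspace_span] by blast
  moreover have "card (C - {b}) + length (y # ys) \<le> card B"
    using b(1) C(1,2) card_Suc_Diff1[of C b] by simp
  ultimately show ?case using C(1) by blast
qed

end

section \<open>The filtration \<open>W\<close> of a derivation and an ideal\<close>

locale lie_ideal_derivation = lie_algebra scale bracket
  for scale :: "'k::field_char_0 \<Rightarrow> 'g::ab_group_add \<Rightarrow> 'g" and bracket +
  fixes D :: "'g \<Rightarrow> 'g" and M :: "'g set"
  assumes derivation: "lie_derivation D" and ideal: "lie_ideal M"
begin

lemma linear_D: "Vector_Spaces.linear scale scale D"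
  using derivation by (simp add: lie_derivation_def)

sublocale D: Vector_Spaces.linear scale scale D
  by (rule linear_D)

lemma D_bracket: "D (bracket x y) = bracket (D x) y + bracket x (D y)"
  using derivation by (simp add: lie_derivation_def)

lemma subspace_M: "subspace M"
  using ideal by (simp add: lie_ideal_def)

lemma bracket_M_right: "y \<in> M \<Longrightarrow> bracket x y \<in> M"
  using ideal by (simp add: lie_ideal_def)

lemma bracket_M_left: "x \<in> M \<Longrightarrow> bracket x y \<in> M"
  using ideal by (rule lie_ideal_bracket_left)

fun W :: "nat \<Rightarrow> 'g set" where
  "W 0 = UNIV"
| "W (Suc d) = {x \<in> M. D x \<in> W d}"

lemma subspace_W: "subspace (W d)"
proof (induction d)
  case 0
  then show ?case by (simp add: subspace_UNIV)
next
  case (Suc d)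
  then show ?case using subspace_M
    by (auto simp: subspace_def D.add D.scale D.zero)
qed

lemma W_Suc_subset: "W (Suc d) \<subseteq> W d"
  by (induction d) auto

text \<open>By the Leibniz rule each \<open>W d\<close> is an ideal; \<open>g\<close> varies in the
  induction because it gets replaced by \<open>D g\<close>.\<close>

lemma bracket_W_left: "x \<in> W d \<Longrightarrow> bracket x g \<in> W d"
proof (induction d arbitrary: x g)
  case (Suc d)
  then have "x \<in> W d" using W_Suc_subset by blast
  then show ?case using Suc
    by (auto simp: D_bracket bracket_M_left intro: subspace_add[OF subspace_W])
qed simp

text \<open>\<open>W 1\<close> is \<open>M\<close>. Of the two Leibniz terms,
  \<open>[D a, b]\<close> is handled by the ideal property of \<open>W (Suc d)\<close> and
  \<open>[a, D b]\<close> by induction.\<close>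

lemma bracket_W_1:
  assumes "a \<in> W 1" "b \<in> W d"
  shows "bracket a b \<in> W (Suc d)"
  using assms
proof (induction d arbitrary: b)
  case 0
  then show ?case by (simp add: bracket_M_left)
next
  case (Suc d)
  have "bracket (D a) b \<in> W (Suc d)"
    using bracket_W_left[OF Suc.prems(2), of "- D a"] subspace_neg[OF subspace_W]
      bracket_swap[of "D a" b] bracket_W_left[OF Suc.prems(2), of "D a"] by metis
  moreover have "bracket a (D b) \<in> W (Suc d)" using Suc by simp
  ultimately have "D (bracket a b) \<in> W (Suc d)"
    unfolding D_bracket by (rule subspace_add[OF subspace_W])
  then show ?case using Suc.prems by (simp add: bracket_M_left)
qed

text \<open>The recursion of \<open>W\<close> peels off the first power of \<open>D\<close>; this
  form peels off the last.\<close>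

lemma W_Suc_iff: "x \<in> W (Suc d) \<longleftrightarrow> x \<in> W d \<and> (D ^^ d) x \<in> M"
proof (induction d arbitrary: x)
  case (Suc d)
  have "x \<in> W (Suc (Suc d)) \<longleftrightarrow> x \<in> M \<and> D x \<in> W (Suc d)" by simp
  also have "\<dots> \<longleftrightarrow> x \<in> M \<and> D x \<in> W d \<and> (D ^^ d) (D x) \<in> M" by (simp only: Suc)
  finally show ?case by (simp add: funpow_swap1)
qed simp

lemma D_pow_add: "(D ^^ d) (x + y) = (D ^^ d) x + (D ^^ d) y"
  by (induction d) (simp_all add: D.add)

lemma D_pow_diff: "(D ^^ d) (x - y) = (D ^^ d) x - (D ^^ d) y"
  by (induction d) (simp_all add: D.diff)

lemma D_pow_scale: "(D ^^ d) (scale c x) = scale c ((D ^^ d) x)"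
  by (induction d) (simp_all add: D.scale)

text \<open>In the Leibniz expansion, the terms with fewer than \<open>d\<close> derivatives on
  \<open>x\<close> lie in \<open>M\<close>.\<close>

lemma D_pow_bracket:
  assumes "x \<in> W d"
  shows "(D ^^ d) (bracket x g) - bracket ((D ^^ d) x) g \<in> M"
  using assms
proof (induction d arbitrary: x g)
  case 0
  then show ?case using subspace_M by (simp add: subspace_0)
next
  case (Suc d)
  have "(D ^^ d) (bracket (D x) g) - bracket ((D ^^ d) (D x)) g \<in> M" using Suc by simp
  moreover have "(D ^^ d) (bracket x (D g)) \<in> M"
    using bracket_W_left[OF Suc.prems] W_Suc_iff by blast
  ultimately have "((D ^^ d) (bracket (D x) g) - bracket ((D ^^ d) (D x)) g)
      + (D ^^ d) (bracket x (D g)) \<in> M" by (rule subspace_add[OF subspace_M])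
  then show ?case
    by (simp add: funpow_swap1 D_bracket D_pow_add algebra_simps)
qed

text \<open>In the binomial Leibniz formula, \<open>a \<in> M\<close> kills the term without a
  derivative on \<open>a\<close>, and \<open>b \<in> W d\<close> kills those with fewer than
  \<open>d\<close> on \<open>b\<close>. One term remains, with coefficient
  \<open>d + 1\<close>.\<close>

lemma D_pow_Suc_bracket:
  assumes "a \<in> M" "b \<in> W d"
  shows "(D ^^ Suc d) (bracket a b) - scale (of_nat (Suc d)) (bracket (D a) ((D ^^ d) b)) \<in> M"
  using assms(2)
proof (induction d arbitrary: b)
  case 0
  then show ?case using assms(1) by (simp add: D_bracket bracket_M_left)
next
  case (Suc d)
  let ?t = "bracket (D a) ((D ^^ Suc d) b)"
  have 1: "(D ^^ Suc d) (bracket a (D b)) - scale (of_nat (Suc d)) ?t \<in> M"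
    using Suc.IH[of "D b"] Suc.prems by (simp only: W.simps mem_Collect_eq funpow_Suc_right o_apply)
  have "- ((D ^^ Suc d) (bracket b (D a)) - bracket ((D ^^ Suc d) b) (D a)) \<in> M"
    by (rule subspace_neg[OF subspace_M D_pow_bracket[OF Suc.prems]])
  moreover have "(D ^^ Suc d) (bracket (D a) b) = - (D ^^ Suc d) (bracket b (D a))"
    using D_pow_diff[of "Suc d" 0 "bracket b (D a)"] D_pow_diff[of "Suc d" 0 0]
      bracket_swap[of "D a" b] by simp
  ultimately have 2: "(D ^^ Suc d) (bracket (D a) b) - ?t \<in> M"
    using bracket_swap[of "D a" "(D ^^ Suc d) b"] by (simp add: algebra_simps)
  have "(D ^^ Suc (Suc d)) (bracket a b) =
      (D ^^ Suc d) (bracket (D a) b) + (D ^^ Suc d) (bracket a (D b))"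
    by (simp only: funpow_Suc_right[of "Suc d"] o_apply D_bracket D_pow_add)
  moreover have "scale (of_nat (Suc (Suc d))) ?t = ?t + scale (of_nat (Suc d)) ?t"
    by (simp only: of_nat_Suc[of "Suc d"] scale_left_distrib scale_one)
  ultimately show ?case using subspace_add[OF subspace_M 2 1] by (simp add: algebra_simps)
qed

text \<open>The elements reached form a subspace containing \<open>M\<close>, so by
  \<open>gen\<close> it suffices to reach brackets \<open>[x, y]\<close>. Lift \<open>x\<close>
  through \<open>D\<close> to \<open>a\<close> and \<open>y\<close> through \<open>D ^^ d\<close> to
  \<open>b\<close>; then \<open>[a, b]\<close> divided by \<open>d + 1\<close> works.\<close>

lemma D_pow_onto_quotient:
  assumes onto: "\<And>g. \<exists>m\<in>M. g - D m \<in> M"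
    and gen: "span ({bracket x y | x y. True} \<union> M) = UNIV"
  shows "\<exists>x\<in>W d. g - (D ^^ d) x \<in> M"
proof (induction d arbitrary: g)
  case 0
  then show ?case using subspace_M by (auto intro!: exI[of _ g] simp: subspace_0)
next
  case (Suc d)
  let ?A = "{g. \<exists>x\<in>W (Suc d). g - (D ^^ Suc d) x \<in> M}"
  have "subspace ?A"
  proof (rule subspaceI)
    show "0 \<in> ?A"
      using subspace_0[OF subspace_W, of "Suc d"] subspace_0[OF subspace_M] D_pow_diff[of "Suc d" 0 0]
      by (intro CollectI bexI[of _ 0]) auto
  next
    fix g h assume "g \<in> ?A" "h \<in> ?A"
    then obtain x y where "x \<in> W (Suc d)" "g - (D ^^ Suc d) x \<in> M"
      "y \<in> W (Suc d)" "h - (D ^^ Suc d) y \<in> M" by blast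
    then have "x + y \<in> W (Suc d)" "(g + h) - (D ^^ Suc d) (x + y) \<in> M"
      using subspace_add[OF subspace_W] subspace_add[OF subspace_M]
      unfolding D_pow_add add_diff_add by blast+
    then show "g + h \<in> ?A" by blast
  next
    fix c g assume "g \<in> ?A"
    then obtain x where "x \<in> W (Suc d)" "g - (D ^^ Suc d) x \<in> M" by blast
    then have "scale c x \<in> W (Suc d)" "scale c g - (D ^^ Suc d) (scale c x) \<in> M"
      using subspace_scale[OF subspace_W] subspace_scale[OF subspace_M]
      unfolding D_pow_scale scale_right_diff_distrib[symmetric] by blast+
    then show "scale c g \<in> ?A" by blast
  qed
  moreover have "{bracket x y | x y. True} \<union> M \<subseteq> ?A"
  proof
    fix z assume "z \<in> {bracket x y | x y. True} \<union> M"
    then consider x y where "z = bracket x y" | "z \<in> M" by blast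
    then show "z \<in> ?A"
    proof cases
      case 1
      obtain a where a: "a \<in> M" "x - D a \<in> M" using onto by blast
      obtain b where b: "b \<in> W d" "y - (D ^^ d) b \<in> M" using Suc by blast
      let ?n = "of_nat (Suc d) :: 'k"
      have n: "?n \<noteq> 0" by (simp del: of_nat_Suc)
      have ab: "bracket a b \<in> W (Suc d)" using bracket_W_1[of a b d] a b by simp
      have "scale (inverse ?n) ((D ^^ Suc d) (bracket a b) - scale ?n (bracket (D a) ((D ^^ d) b))) \<in> M"
        using D_pow_Suc_bracket[OF a(1) b(1)] by (rule subspace_scale[OF subspace_M])
      then have e1: "(D ^^ Suc d) (scale (inverse ?n) (bracket a b)) - bracket (D a) ((D ^^ d) b) \<in> M"
        using n by (simp add: scale_right_diff_distrib D_pow_scale del: of_nat_Suc funpow.simps)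
      have e2: "bracket (x - D a) y + bracket (D a) (y - (D ^^ d) b) \<in> M"
        using a b by (intro subspace_add[OF subspace_M] bracket_M_left bracket_M_right)
      have "z - (D ^^ Suc d) (scale (inverse ?n) (bracket a b)) =
        (bracket (x - D a) y + bracket (D a) (y - (D ^^ d) b)) -
        ((D ^^ Suc d) (scale (inverse ?n) (bracket a b)) - bracket (D a) ((D ^^ d) b))"
        by (simp add: 1 bracket_diff_left bracket_diff_right del: of_nat_Suc funpow.simps)
      also have "\<dots> \<in> M" using e2 e1 by (rule subspace_diff[OF subspace_M])
      finally show ?thesis using subspace_scale[OF subspace_W ab] by blast
    next
      case 2
      then show ?thesis
        using subspace_0[OF subspace_W, of "Suc d"] D_pow_diff[of "Suc d" 0 0]
        by (intro CollectI bexI[of _ 0]) auto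
    qed
  qed
  ultimately have "span ({bracket x y | x y. True} \<union> M) \<subseteq> ?A" by (rule span_minimal[rotated])
  then show ?case using gen by blast
qed

section \<open>Nested brackets along the filtration\<close>

text \<open>Since \<open>x\<close> stays in the leftmost position, \<open>D_pow_bracket\<close>
  applies at every level, with \<open>ys\<close> left untouched.\<close>

lemma nested_bracket_W:
  assumes "x \<in> W d"
  shows "nested_bracket ys x \<in> W d \<and> (D ^^ d) (nested_bracket ys x) - nested_bracket ys ((D ^^ d) x) \<in> M"
proof (induction ys)
  case Nil
  then show ?case using assms subspace_M by (simp add: subspace_0)
next
  case (Cons y ys)
  let ?f = "nested_bracket ys"
  have "(D ^^ d) (bracket (?f x) (?f y)) - bracket ((D ^^ d) (?f x)) (?f y) \<in> M"
    using D_pow_bracket Cons by blast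
  moreover have "bracket ((D ^^ d) (?f x) - ?f ((D ^^ d) x)) (?f y) \<in> M"
    using Cons bracket_M_left by blast
  ultimately have "((D ^^ d) (bracket (?f x) (?f y)) - bracket ((D ^^ d) (?f x)) (?f y))
      + bracket ((D ^^ d) (?f x) - ?f ((D ^^ d) x)) (?f y) \<in> M"
    by (rule subspace_add[OF subspace_M])
  then show ?case using Cons bracket_W_left by (simp add: bracket_diff_left)
qed

text \<open>First-order expansion: moving every argument \<open>z\<close> to
  \<open>z + s D z\<close> gives a polynomial in \<open>s\<close> whose linear coefficient is the
  Leibniz sum. \<open>N \<ge> 2\<close> makes index 1 a genuine coefficient.\<close>

lemma nested_bracket_perturb:
  "\<exists>N c. N \<ge> 2 \<and> c 0 = nested_bracket ys x \<and> c 1 = D (nested_bracket ys x) \<and>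
    (\<forall>s. nested_bracket (map (\<lambda>y. y + scale s (D y)) ys) (x + scale s (D x)) =
      (\<Sum>j<N. scale (s ^ j) (c j)))"
proof (induction ys arbitrary: x)
  case Nil
  show ?case
    by (rule exI[of _ 2], rule exI[of _ "\<lambda>j. if j = 0 then x else D x"]) (simp add: numeral_2_eq_2)
next
  case (Cons y ys)
  let ?p = "\<lambda>s. map (\<lambda>y. y + scale s (D y)) ys"
  obtain N c where c: "N \<ge> 2" "c 0 = nested_bracket ys x" "c 1 = D (nested_bracket ys x)"
    "\<And>s. nested_bracket (?p s) (x + scale s (D x)) = (\<Sum>j<N. scale (s ^ j) (c j))"
    using Cons[of x] by blast
  obtain N' d where d: "N' \<ge> 2" "d 0 = nested_bracket ys y" "d 1 = D (nested_bracket ys y)"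
    "\<And>s. nested_bracket (?p s) (y + scale s (D y)) = (\<Sum>j<N'. scale (s ^ j) (d j))"
    using Cons[of y] by blast
  let ?e = "\<lambda>k. \<Sum>(i, j) | (i, j) \<in> {..<N} \<times> {..<N'} \<and> i + j = k. bracket (c i) (d j)"
  have "{(i, j). (i, j) \<in> {..<N} \<times> {..<N'} \<and> i + j = 0} = {(0, 0)}" using c(1) d(1) by auto
  then have e0: "?e 0 = nested_bracket (y # ys) x" using c(2) d(2) by simp
  have "{(i, j). (i, j) \<in> {..<N} \<times> {..<N'} \<and> i + j = 1} = {(0, 1), (1, 0)}"
    using c(1) d(1) by (auto simp: add_is_1)
  then have "?e 1 = bracket (c 0) (d 1) + bracket (c 1) (d 0)" by simp
  then have e1: "?e 1 = D (nested_bracket (y # ys) x)" using c(2,3) d(2,3) by (simp add: D_bracket)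
  have "nested_bracket (map (\<lambda>y. y + scale s (D y)) (y # ys)) (x + scale s (D x)) =
      (\<Sum>k<N + N'. scale (s ^ k) (?e k))" for s
    by (simp only: list.map nested_bracket.simps c(4) d(4) bracket_polynomials)
  then show ?case using c(1) e0 e1 by (intro exI[of _ "N + N'"] exI[of _ ?e]) auto
qed

text \<open>The identity also holds at all perturbed arguments. If those values lie in
  \<open>W d\<close>, so does their linear coefficient, the \<open>D\<close>-image of the original
  value.\<close>

lemma nested_bracket_identity_W:
  assumes "\<And>ys x. length ys = k \<Longrightarrow> nested_bracket ys x \<in> M" and "length ys = k"
  shows "nested_bracket ys x \<in> W d"
  using assms(2)
proof (induction d arbitrary: ys x)
  case (Suc d)
  obtain N c where c: "N \<ge> 2" "c 1 = D (nested_bracket ys x)"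
    "\<And>s. nested_bracket (map (\<lambda>y. y + scale s (D y)) ys) (x + scale s (D x)) =
      (\<Sum>j<N. scale (s ^ j) (c j))"
    using nested_bracket_perturb[of ys x] by blast
  have "(\<Sum>j<N. scale (s ^ j) (c j)) \<in> W d" for s
    using Suc.IH[of "map (\<lambda>y. y + scale s (D y)) ys" "x + scale s (D x)"] Suc.prems c(3)[of s]
    by simp
  then have "c 1 \<in> W d"
    using polynomial_coeffs_in_subspace[OF vector_space_axioms subspace_W, where j = 1 and N = N] c(1)
    by simp
  then show ?case using c(2) assms(1) Suc.prems by simp
qed simp

section \<open>Finite codimension and the contradiction\<close>

text \<open>Generators of \<open>M\<close> modulo \<open>[M, M]\<close> are mapped by
  \<open>D\<close> to generators of everything modulo \<open>M\<close>, because \<open>D\<close>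
  sends \<open>[M, M]\<close> into \<open>M\<close>.\<close>

lemma finite_codim:
  assumes onto: "\<And>g. \<exists>m\<in>M. g - D m \<in> M" and wn: weakly_noetherian
  obtains B where "finite B" "span (M \<union> B) = UNIV"
proof -
  have "lie_subalgebra M" using subspace_M bracket_M_left by (auto simp: lie_subalgebra_def)
  then have "quotient_dim M (derived_subalgebra M) < \<infinity>" using wn by (simp add: weakly_noetherian_def)
  then obtain B where B: "finite B" "B \<subseteq> M"
    "\<And>v. v \<in> M \<Longrightarrow> \<exists>x\<in>span B. v - x \<in> derived_subalgebra M"
    by (rule quotient_dim_finiteE) blast
  have "{bracket x y | x y. x \<in> M \<and> y \<in> M} \<subseteq> W 2"
    using bracket_W_1[of _ _ 1] by (auto simp: numeral_2_eq_2)
  then have der: "derived_subalgebra M \<subseteq> W 2"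
    unfolding derived_subalgebra_def using subspace_W by (rule span_minimal)
  have "g \<in> span (M \<union> D ` B)" for g
  proof -
    obtain m where m: "m \<in> M" "g - D m \<in> M" using onto by blast
    obtain x where x: "x \<in> span B" "m - x \<in> W 2" using B(3)[OF m(1)] der by blast
    have "D x \<in> span (D ` B)" using x(1) D.span_image by auto
    then have Dx: "D x \<in> span (M \<union> D ` B)"
      using span_mono[of "D ` B" "M \<union> D ` B"] by blast
    have "D m - D x \<in> M" using x(2) by (simp add: numeral_2_eq_2 D.diff)
    then have "(g - D m) + (D m - D x) \<in> M" using m(2) subspace_add[OF subspace_M] by blast
    then have "g - D x \<in> span (M \<union> D ` B)" by (simp add: span_base)
    from span_add[OF this Dx] show ?thesis by simp
  qed
  then show thesis using that[of "D ` B"] B(1) by blast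
qed

lemma derivation_not_onto_quotient:
  assumes wn: weakly_noetherian and proper: "M \<noteq> UNIV"
    and gen: "span ({bracket x y | x y. True} \<union> M) = UNIV"
    and onto: "\<And>g. \<exists>m\<in>M. g - D m \<in> M"
  shows False
proof -
  obtain B where B: "finite B" "span (M \<union> B) = UNIV" using finite_codim[OF onto wn] .
  let ?P = "\<lambda>k. \<exists>ys x. length ys = k \<and> nested_bracket ys x \<notin> M"
  have "?P 0" using proper by auto
  moreover have "\<not> ?P (Suc (card B))"
    using nested_bracket_kernel_codim[OF ideal B] by fastforce
  \<comment> \<open>The last length at which some nested bracket is nonzero modulo
    \<open>M\<close>.\<close>
  ultimately obtain k where k: "?P k" "\<not> ?P (Suc k)"
    using nat_induct[of ?P] by blast
  then obtain ys x where ys: "length ys = k" "nested_bracket ys x \<notin> M" by blast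
  have "\<exists>g. \<forall>d. g d \<in> W d \<and> x - (D ^^ d) (g d) \<in> M"
    using D_pow_onto_quotient[OF onto gen] by (intro choice) blast
  then obtain g where g: "\<And>d. g d \<in> W d" "\<And>d. x - (D ^^ d) (g d) \<in> M" by blast
  define v where "v d = nested_bracket ys (g d)" for d
  have vW: "v d \<in> W d" for d using nested_bracket_W[OF g(1)] by (simp add: v_def)
  \<comment> \<open>Modulo \<open>M\<close>, \<open>D ^^ d\<close> sends \<open>v d\<close> to
    \<open>nested_bracket ys x\<close>, which is nonzero there.\<close>
  have vW': "v d \<notin> W (Suc d)" for d
  proof
    assume "v d \<in> W (Suc d)"
    then have "(D ^^ d) (v d) \<in> M" using W_Suc_iff by blast
    moreover have "(D ^^ d) (v d) - nested_bracket ys ((D ^^ d) (g d)) \<in> M"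
      using nested_bracket_W[OF g(1)] by (simp add: v_def)
    ultimately have "(D ^^ d) (v d) - ((D ^^ d) (v d) - nested_bracket ys ((D ^^ d) (g d))) \<in> M"
      by (rule subspace_diff[OF subspace_M])
    then have "nested_bracket ys ((D ^^ d) (g d)) \<in> M" by simp
    moreover have "nested_bracket ys x - nested_bracket ys ((D ^^ d) (g d)) \<in> M"
      using nested_bracket_ideal[OF ideal g(2)] by (simp add: nested_bracket_diff)
    ultimately have "nested_bracket ys x \<in> M" using subspace_add[OF subspace_M] by fastforce
    then show False using ys(2) by blast
  qed
  define I where "I = (\<Inter>d. W d)"
  have sI: "subspace I" unfolding I_def by (rule subspace_Inter) (auto simp: subspace_W)
  have I_left: "bracket a b \<in> I" if "a \<in> I" for a b
    using that bracket_W_left by (auto simp: I_def)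
  have I_right: "bracket a b \<in> I" if "b \<in> I" for a b
    using I_left[OF that, of a] bracket_swap[of a b] subspace_neg[OF sI] by metis
  \<comment> \<open>This bracket is itself a nested bracket, of length \<open>Suc k\<close>.\<close>
  have comm: "bracket (v d) (v e) \<in> I" for d e
    using nested_bracket_identity_W[of "Suc k" "g e # ys" "g d"] k(2) ys(1)
    by (auto simp: I_def v_def)
  let ?X = "range v \<union> I"
  have br: "bracket a b \<in> I" if "a \<in> span ?X" "b \<in> span ?X" for a b
    using sI _ that by (rule bracket_span_mem) (use comm I_left I_right in auto)
  have "I \<subseteq> span ?X" using span_superset by blast
  then have "lie_subalgebra (span ?X)" using br by (auto simp: lie_subalgebra_def)
  then have "quotient_dim (span ?X) (derived_subalgebra (span ?X)) < \<infinity>"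
    using wn by (simp add: weakly_noetherian_def)
  then obtain C where C: "finite C"
    "\<And>v. v \<in> span ?X \<Longrightarrow> \<exists>x\<in>span C. v - x \<in> derived_subalgebra (span ?X)"
    by (rule quotient_dim_finiteE) blast
  have "derived_subalgebra (span ?X) \<subseteq> I"
    unfolding derived_subalgebra_def by (rule span_minimal[OF _ sI]) (use br in blast)
  moreover have "v d \<in> span ?X" for d by (simp add: span_base)
  ultimately have "\<exists>u. \<forall>d. u d \<in> span C \<and> v d - u d \<in> I"
    using C(2) by (intro choice) blast
  then obtain u where u: "\<And>d. u d \<in> span C" "\<And>d. v d - u d \<in> I" by blast
  \<comment> \<open>Changing \<open>v d\<close> by an element of \<open>I\<close> preserves its
    place in the filtration, so the chain argument applies inside \<open>span C\<close>.\<close>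
  have *: "u d \<in> W e \<longleftrightarrow> v d \<in> W e" for d e
  proof -
    have "v d - u d \<in> W e" using u(2) by (auto simp: I_def)
    then show ?thesis
      using subspace_add[OF subspace_W, of "v d - u d" e "u d"]
        subspace_diff[OF subspace_W, of "v d" e "v d - u d"] by auto
  qed
  then have "u d \<in> W d" "u d \<notin> W (Suc d)" for d using vW vW' by blast+
  with subspace_W W_Suc_subset have "infinite C" by (rule descending_not_finite_span) (rule u(1))
  then show False using C(1) by simp
qed

section \<open>The ideal \<open>M + D M\<close>\<close>

lemma subspace_M_plus_image: "subspace {g. \<exists>m\<in>M. g - D m \<in> M}"
proof (rule subspaceI)
  show "0 \<in> {g. \<exists>m\<in>M. g - D m \<in> M}"
    using subspace_0[OF subspace_M] by (auto intro!: bexI[of _ 0] simp: D.zero)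
next
  fix g h assume "g \<in> {g. \<exists>m\<in>M. g - D m \<in> M}" "h \<in> {g. \<exists>m\<in>M. g - D m \<in> M}"
  then obtain m n where "m \<in> M" "g - D m \<in> M" "n \<in> M" "h - D n \<in> M" by blast
  then have "m + n \<in> M" "(g + h) - D (m + n) \<in> M"
    using subspace_add[OF subspace_M] unfolding D.add add_diff_add by blast+
  then show "g + h \<in> {g. \<exists>m\<in>M. g - D m \<in> M}" by blast
next
  fix c g assume "g \<in> {g. \<exists>m\<in>M. g - D m \<in> M}"
  then obtain m where "m \<in> M" "g - D m \<in> M" by blast
  then have "scale c m \<in> M" "scale c g - D (scale c m) \<in> M"
    using subspace_scale[OF subspace_M] unfolding D.scale scale_right_diff_distrib[symmetric]
    by blast+
  then show "scale c g \<in> {g. \<exists>m\<in>M. g - D m \<in> M}" by blast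
qed

text \<open>Leibniz gives \<open>[x, D m] = D [x, m] - [D x, m]\<close>, where \<open>[x, m]\<close>
  and \<open>[D x, m]\<close> lie in \<open>M\<close>.\<close>

lemma lie_ideal_M_plus_image: "lie_ideal {g. \<exists>m\<in>M. g - D m \<in> M}"
  unfolding lie_ideal_def
proof (intro conjI allI ballI)
  fix x y assume "y \<in> {g. \<exists>m\<in>M. g - D m \<in> M}"
  then obtain m where m: "m \<in> M" "y - D m \<in> M" by blast
  have "bracket x y - D (bracket x m) = bracket x (y - D m) - bracket (D x) m"
    by (simp add: D_bracket bracket_diff_right)
  also have "\<dots> \<in> M" using subspace_diff[OF subspace_M bracket_M_right[OF m(2)] bracket_M_right[OF m(1)]] .
  finally show "bracket x y \<in> {g. \<exists>m\<in>M. g - D m \<in> M}" using m(1) bracket_M_right by blast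
qed (rule subspace_M_plus_image)

end

theorem theorem41:
  fixes scale :: "'k::field_char_0 \<Rightarrow> 'g::ab_group_add \<Rightarrow> 'g"
    and bracket :: "'g \<Rightarrow> 'g \<Rightarrow> 'g"
    and M :: "'g set"
  assumes "lie_algebra scale bracket"
    and "lie_algebra.weakly_noetherian scale bracket"
    and "lie_algebra.maximal_lie_ideal scale bracket M"
    and "lie_algebra.quotient_dim scale UNIV M > 1"
  shows "lie_algebra.characteristic_ideal scale bracket M"
proof -
  interpret lie_algebra scale bracket by fact
  note max = assms(3)
  have M: "lie_ideal M" "M \<noteq> UNIV" using max by (auto simp: maximal_lie_ideal_def)
  have "D m \<in> M" if D: "lie_derivation D" and m: "m \<in> M" for D m
  proof (rule ccontr)
    assume Dm: "D m \<notin> M"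
    interpret lie_ideal_derivation scale bracket D M
      by unfold_locales (use D M in auto)
    let ?J = "{g. \<exists>m\<in>M. g - D m \<in> M}"
    have "M \<subseteq> ?J" using subspace_0[OF subspace_M] by (auto intro!: bexI[of _ 0] simp: D.zero)
    moreover have "D m \<in> ?J" using m subspace_0[OF subspace_M] by (auto intro!: bexI[of _ m])
    ultimately have J: "?J = UNIV"
      using max lie_ideal_M_plus_image Dm unfolding maximal_lie_ideal_def by blast
    \<comment> \<open>Any subspace containing all brackets is an ideal; as \<open>?L\<close> exceeds
      \<open>M\<close>, it is everything, so the quotient is perfect.\<close>
    let ?L = "span ({bracket x y | x y. True} \<union> M)"
    have brL: "bracket x y \<in> ?L" for x y by (rule span_base) blast
    then have "lie_ideal ?L" by (simp add: lie_ideal_def)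
    moreover have "M \<subseteq> ?L" using span_superset by blast
    moreover have "?L \<noteq> M" using maximal_ideal_not_abelian[OF max assms(4)] brL by blast
    ultimately have "?L = UNIV" using max unfolding maximal_lie_ideal_def by blast
    then show False
      using derivation_not_onto_quotient[OF assms(2) M(2)] J by blast
  qed
  then show ?thesis using M(1) by (auto simp: characteristic_ideal_def)
qed

end
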